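(* Let $(\Omega,\mathcal F,\mathbb P)$ be a complete probability space with a filtration $(\mathcal F_n)_{n\ge0}$ such that $\mathcal F=\sigma(\bigcup_n\mathcal F_n)$ and every $\mathcal F_n$ is generated by countably many atoms. Let $p(\cdot):\Omega\to(0,\infty)$ be measurable with $1<p_-\le p_+<\infty$, and assume there is a constant $K\ge1$ such that $\mathbb P(A)^{p_-(A)-p_+(A)}\le K$ for every atom $A$ of every $\mathcal F_n$. Then there is a constant $C$, independent of $(\theta_n)$, such that for every sequence $(\theta_n)_{n\ge0}$ of arbitrary random variables (not assumed adapted), $$\Big\|\sum_{n\ge0}|\mathbb E_n(\theta_n)|\Big\|_{p(\cdot)}\le C\,\Big\|\sum_{n\ge0}|\theta_n|\Big\|_{p(\cdot)}.$$
   Context: For measurable $A$, $p_-(A)=\operatorname{ess\,inf}_Ap$, $p_+(A)=\operatorname{ess\,sup}_Ap$; $p_\pm=p_\pm(\Omega)$. $\|f\|_{p(\cdot)}=\inf\{\lambda>0:\int_\Omega(|f|/\lambda)^{p(x)}d\mathbb P\le1\}$. $B\in\mathcal F_n$ (of positive measure) is an atom of $\mathcal F_n$ if every $A\subset B$, $A\in\mathcal F_n$ with $\mathbb P(A)<\mathbb P(B)$ has $\mathbb P(A)=0$. $\mathbb E_n=\mathbb E(\cdot|\mathcal F_n)$. The inequality is vacuous when the right-hand side is infinite; when it is finite every $\theta_n$ is integrable, so $\mathbb E_n(\theta_n)$ is defined. *)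

theory Defs
  imports "HOL-Probability.Probability"
begin

definition ess_sup_on :: "'a measure \<Rightarrow> ('a \<Rightarrow> real) \<Rightarrow> 'a set \<Rightarrow> ereal" where
  "ess_sup_on M p A = esssup (restrict_space M A) (\<lambda>x. ereal (p x))"

definition ess_inf_on :: "'a measure \<Rightarrow> ('a \<Rightarrow> real) \<Rightarrow> 'a set \<Rightarrow> ereal" where
  "ess_inf_on M p A = - esssup (restrict_space M A) (\<lambda>x. - ereal (p x))"

definition is_atom :: "'a measure \<Rightarrow> 'a measure \<Rightarrow> 'a set \<Rightarrow> bool" where
  "is_atom M G B \<longleftrightarrow> B \<in> sets G \<and> 0 < measure M B \<and>
     (\<forall>A\<in>sets G. A \<subseteq> B \<and> measure M A < measure M B \<longrightarrow> measure M A = 0)"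

text \<open>Generation is understood up to null sets of \<open>M\<close>. Literal equality
  \<open>sets G = sigma_sets (space M) \<A>\<close> would exclude the standard examples: the Lebesgue
  sigma-algebra on the unit interval is not literally generated by the dyadic intervals, only
  up to null sets. \<open>G\<close> may, but need not, contain the null sets.\<close>

definition generated_mod_null :: "'a measure \<Rightarrow> 'a measure \<Rightarrow> 'a set set \<Rightarrow> bool" where
  "generated_mod_null M G \<A> \<longleftrightarrow>
     \<A> \<subseteq> sets G \<and> sets G \<subseteq> sigma_sets (space M) (\<A> \<union> null_sets M)"

definition countably_atomic :: "'a measure \<Rightarrow> 'a measure \<Rightarrow> bool" where
  "countably_atomic M G \<longleftrightarrow>
     (\<exists>\<A>. countable \<A> \<and> (\<forall>A\<in>\<A>. is_atom M G A) \<and> generated_mod_null M G \<A>)"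

text \<open>The power \<open>t\<^sup>q\<close> for extended nonnegative \<open>t\<close>; used only for \<open>q > 0\<close>.\<close>

definition epowr :: "ennreal \<Rightarrow> real \<Rightarrow> ennreal" where
  "epowr t q = (if t = \<infinity> then \<infinity> else ennreal (enn2real t powr q))"

text \<open>The quasi-norm of a function whose absolute value is \<open>f\<close>. It is \<open>\<infinity>\<close> if no \<open>\<lambda>\<close> is
  admissible; extended values of \<open>f\<close> allow sums of series of random variables that may diverge.\<close>

definition var_norm :: "'a measure \<Rightarrow> ('a \<Rightarrow> real) \<Rightarrow> ('a \<Rightarrow> ennreal) \<Rightarrow> ennreal" where
  "var_norm M p f =
     Inf {ennreal l | l :: real. 0 < l \<and> (\<integral>\<^sup>+ x. epowr (f x / ennreal l) (p x) \<partial>M) \<le> 1}"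

end

theory Submission
  imports Defs
begin

text \<open>The theorem is a dual form of Doob's maximal inequality, and for a constant exponent
  it has a proof that uses neither duality nor the maximal function. Put
  \<open>c\<^sub>k = \<bar>E\<^sub>k(\<theta>\<^sub>k)\<bar>\<close> and \<open>U\<^sub>n = c\<^sub>0 + \<dots> + c\<^sub>n\<^sub>-\<^sub>1\<close>. Since \<open>t\<^sup>p\<close> is convex,
  \<open>U\<^sub>N\<^sup>p \<le> p (\<Sum>k<N. c\<^sub>k U\<^sub>k\<^sub>+\<^sub>1\<^sup>p\<^sup>-\<^sup>1)\<close>. The factor \<open>U\<^sub>k\<^sub>+\<^sub>1\<^sup>p\<^sup>-\<^sup>1\<close> is \<open>F\<^sub>k\<close>-measurable and
  increases with \<open>k\<close>, so after integration \<open>c\<^sub>k\<close> may be replaced by \<open>\<bar>\<theta>\<^sub>k\<bar>\<close> and then \<open>U\<^sub>k\<^sub>+\<^sub>1\<close> by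
  \<open>U\<^sub>N\<close>, which leaves \<open>p \<integral> f U\<^sub>N\<^sup>p\<^sup>-\<^sup>1\<close> with \<open>f = (\<Sum>k. \<bar>\<theta>\<^sub>k\<bar>)\<close>.

  For a variable exponent \<open>u\<^sup>p\<^sup>-\<^sup>1\<close> is no longer \<open>F\<^sub>k\<close>-measurable when \<open>u = U\<^sub>k\<^sub>+\<^sub>1\<close> is, but it is
  almost so (lemma \<open>powr_le_on_atom\<close>). On an atom \<open>B\<close> of \<open>F\<^sub>k\<close> the function \<open>u\<close> equals
  almost everywhere a constant \<open>s\<close>. If \<open>s > 1\<close> and the modular \<open>\<integral> u\<^sup>p\<close> is at most \<open>1\<close>, then \<open>s\<close> is
  at most the reciprocal of the measure of \<open>B\<close>, so by the condition on the atoms the values of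
  \<open>s\<^sup>p\<^sup>-\<^sup>1\<close> on \<open>B\<close> differ at most by the factor \<open>K\<close>; if \<open>s \<le> 1\<close> they are at most \<open>1\<close>. Hence
  some constant \<open>g\<close> satisfies \<open>u\<^sup>p\<^sup>-\<^sup>1 \<le> g \<le> K u\<^sup>p\<^sup>-\<^sup>1 + 1\<close> on \<open>B\<close>, and the argument
  above yields \<open>\<integral> U\<^sub>N\<^sup>p \<le> p\<^sub>+ \<integral> f (K U\<^sub>N\<^sup>p\<^sup>-\<^sup>1 + 1)\<close> (lemma \<open>modular_sum_le\<close>), where
  \<open>p\<^sub>+\<close> is the essential supremum of \<open>p\<close>, provided that the modular of \<open>U\<^sub>N\<close> is at most \<open>1\<close>.

  Applied to \<open>U\<^sub>N / l\<close> for \<open>f\<close> of modular at most \<open>1\<close>, this bounds the modular of \<open>U\<^sub>N / l\<close> by a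
  multiple of \<open>1 / l\<close> whenever it is at most \<open>1\<close>. An admissible \<open>l\<close> can therefore be halved as long
  as it is at least \<open>C = 2 powr p\<^sub>+ * p\<^sub>+ * (2 K + 2)\<close>, and \<open>C\<close> itself is admissible
  (lemma \<open>modular_bounded_sum_le_1\<close>). Some admissible \<open>l\<close> is needed to start; it exists once the
  \<open>c\<^sub>k\<close> are truncated, which is harmless because only
  \<open>\<integral>\<^sub>A c\<^sub>k \<le> \<integral>\<^sub>A \<bar>\<theta>\<^sub>k\<bar>\<close> for \<open>A \<in> F\<^sub>k\<close> is used. Monotone convergence removes the
  truncation.\<close>

section \<open>Elementary inequalities\<close>

lemma powr_increment_le:
  fixes x c q :: real
  assumes "0 \<le> x" "0 \<le> c" "1 < q"
  shows "(x + c) powr q \<le> x powr q + q * (c * (x + c) powr (q - 1))"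
proof (cases "x + c = 0")
  case False
  define y where "y = x + c"
  have y: "0 < y" using False assms by (simp add: y_def)
  have e: "(q - 1) * (q / (q - 1)) = q" using assms by simp
  \<comment> \<open>Young with exponents \<open>q\<close> and \<open>q / (q - 1)\<close>; this is the tangent inequality at \<open>y\<close>.\<close>
  have "x * y powr (q - 1) \<le> x powr q / q + (y powr (q - 1)) powr (q / (q - 1)) / (q / (q - 1))"
    using assms by (intro Youngs_inequality) (auto simp: field_simps)
  then have "x * y powr (q - 1) \<le> x powr q / q + y powr q * (q - 1) / q"
    using assms(3) by (simp add: powr_powr e)
  then have "q * (x * y powr (q - 1)) \<le> x powr q + y powr q * (q - 1)"
    using assms by (simp add: field_simps)
  moreover have "y powr q = y * y powr (q - 1)"
    using y by (simp add: powr_mult_base)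
  then have "q * (c * y powr (q - 1)) + q * (x * y powr (q - 1)) = q * y powr q"
    by (simp add: y_def algebra_simps)
  ultimately have "y powr q \<le> x powr q + q * (c * y powr (q - 1))"
    by (simp add: algebra_simps)
  then show ?thesis by (simp add: y_def)
qed (use assms in auto)

lemma mult_powr_minus_one_le:
  fixes f u q :: real
  assumes "0 \<le> f" "0 \<le> u" "1 < q"
  shows "f * u powr (q - 1) \<le> f powr q + u powr q"
proof -
  have "f * u powr (q - 1) \<le> max f u * max f u powr (q - 1)"
    using assms by (intro mult_mono powr_mono2) auto
  also have "\<dots> = max f u powr q"
    using assms by (simp add: powr_mult_base)
  also have "\<dots> \<le> f powr q + u powr q" by (simp add: max_def)
  finally show ?thesis .
qed

section \<open>Atoms\<close>

lemma is_atom_cases: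
  assumes "prob_space M" "subalgebra M G" "is_atom M G B" "A \<in> sets G"
  shows "(AE x in M. x \<in> B \<longrightarrow> x \<in> A) \<or> (AE x in M. x \<in> B \<longrightarrow> x \<notin> A)"
proof -
  interpret prob_space M by fact
  have B: "B \<in> sets G" and atom: "\<And>A. A \<in> sets G \<Longrightarrow> A \<subseteq> B \<Longrightarrow> measure M A < measure M B \<Longrightarrow> measure M A = 0"
    using assms(3) by (auto simp: is_atom_def)
  have M[measurable]: "A \<in> sets M" "B \<in> sets M"
    using assms(2,4) B by (auto simp: subalgebra_def)
  have null: "AE x in M. x \<notin> N" if "N \<in> sets M" "measure M N = 0" for N
    using that by (intro AE_not_in) (auto simp: null_sets_def emeasure_eq_measure)
  show ?thesis
  proof (cases "measure M (A \<inter> B) < measure M B")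
    case True
    then have "measure M (A \<inter> B) = 0"
      using B assms(4) by (intro atom) auto
    then have "AE x in M. x \<notin> A \<inter> B" by (intro null) auto
    then show ?thesis by (intro disjI2) (auto elim!: eventually_mono)
  next
    case False
    then have "measure M (A \<inter> B) = measure M B"
      using finite_measure_mono[of "A \<inter> B" B] by auto
    then have "measure M (B - A) = 0"
      by (simp add: finite_measure_Diff' Int_commute)
    then have "AE x in M. x \<notin> B - A" by (intro null) auto
    then show ?thesis by simp
  qed
qed

lemma AE_ex_on_atom:
  assumes "prob_space M" "is_atom M G B" "AE x in M. x \<in> B \<longrightarrow> P x" "subalgebra M G"
  shows "\<exists>x\<in>B. P x"
proof (rule ccontr)
  interpret prob_space M by fact
  have B: "B \<in> sets M" "0 < measure M B"
    using assms(2,4) by (auto simp: is_atom_def subalgebra_def)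
  assume "\<not> ?thesis"
  with assms(3) have "AE x in M. x \<notin> B" by (auto elim: eventually_mono)
  with B(1) have "B \<in> null_sets M" by (simp add: AE_iff_null_sets)
  then have "measure M B = 0" by (auto simp: measure_def)
  with B show False by simp
qed

lemma is_atom_AE_const:
  fixes u :: "'a \<Rightarrow> real"
  assumes "prob_space M" "subalgebra M G" "is_atom M G B" "u \<in> borel_measurable G"
  shows "\<exists>s. AE x in M. x \<in> B \<longrightarrow> u x = s"
proof -
  interpret prob_space M by fact
  note [measurable] = assms(4)
  \<comment> \<open>A real number is determined by the rationals above it, and on an atom each comparison with
    a rational has a constant truth value almost everywhere.\<close>
  have "\<exists>b. AE x in M. x \<in> B \<longrightarrow> (u x < of_rat r \<longleftrightarrow> b)" for r
  proof -
    have "{x \<in> space G. u x < of_rat r} \<in> sets G" by measurable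
    from is_atom_cases[OF assms(1-3) this] show ?thesis
    proof
      assume "AE x in M. x \<in> B \<longrightarrow> x \<in> {x \<in> space G. u x < of_rat r}"
      then show ?thesis by (intro exI[of _ True]) (auto elim!: eventually_mono)
    next
      assume "AE x in M. x \<in> B \<longrightarrow> x \<notin> {x \<in> space G. u x < of_rat r}"
      moreover have "B \<subseteq> space G"
        using assms(3) sets.sets_into_space by (auto simp: is_atom_def)
      ultimately show ?thesis by (intro exI[of _ False]) (auto elim!: eventually_mono)
    qed
  qed
  then obtain b where "\<And>r. AE x in M. x \<in> B \<longrightarrow> (u x < of_rat r \<longleftrightarrow> b r)" by metis
  then have ae: "AE x in M. x \<in> B \<longrightarrow> (\<forall>r. u x < of_rat r \<longleftrightarrow> b r)"
    by (simp add: AE_all_countable flip: all_simps)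
  obtain y where y: "y \<in> B" "\<And>r. u y < of_rat r \<longleftrightarrow> b r"
    using AE_ex_on_atom[OF assms(1,3) ae assms(2)] by auto
  have "u x = u y" if "\<forall>r. u x < of_rat r \<longleftrightarrow> b r" for x
    using that y(2) of_rat_dense[of "u x" "u y"] of_rat_dense[of "u y" "u x"]
    by (metis less_asym not_less_iff_gr_or_eq)
  with ae show ?thesis by (intro exI[of _ "u y"]) (auto elim: eventually_mono)
qed

text \<open>The generating atoms need neither be disjoint nor cover the space. Overlaps are
  removed by disjointing the sequence, and each piece is again an atom or a null set. The rest
  \<open>R\<close> of the space is disjoint from all the generators, so every set of the sigma-algebra contains
  almost all or almost nothing of \<open>R\<close>; thus \<open>R\<close> is one more atom unless it is null.\<close>

lemma countably_atomic_partition: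
  assumes "prob_space M" "subalgebra M G" "countably_atomic M G"
  shows "\<exists>D :: nat \<Rightarrow> 'a set. disjoint_family D \<and> (\<Union>i. D i) = space M \<and>
    (\<forall>i. D i \<in> sets G \<and> (is_atom M G (D i) \<or> measure M (D i) = 0))"
proof -
  interpret prob_space M by fact
  have GM: "\<And>A. A \<in> sets G \<Longrightarrow> A \<in> sets M" and sp: "space G = space M"
    using assms(2) by (auto simp: subalgebra_def)
  obtain \<A> where \<A>: "countable \<A>" "\<And>A. A \<in> \<A> \<Longrightarrow> is_atom M G A"
    "\<A> \<subseteq> sets G" "sets G \<subseteq> sigma_sets (space M) (\<A> \<union> null_sets M)"
    using assms(3) by (auto simp: countably_atomic_def generated_mod_null_def)
  define R where "R = space M - \<Union>\<A>"
  have RG: "R \<in> sets G"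
    unfolding R_def sp[symmetric] using \<A> by (intro sets.Diff sets.top sets.countable_Union) auto
  then have R[measurable]: "R \<in> sets M" by (rule GM)
  have triv: "(AE x in M. x \<in> R \<longrightarrow> x \<in> E) \<or> (AE x in M. x \<in> R \<longrightarrow> x \<notin> E)"
    if "E \<in> sigma_sets (space M) (\<A> \<union> null_sets M)" for E
    using that
  proof induction
    case (Basic a)
    then show ?case
    proof
      assume "a \<in> \<A>"
      then show ?thesis by (auto simp: R_def)
    next
      assume "a \<in> null_sets M"
      then have "AE x in M. x \<notin> a" by (rule AE_not_in)
      then show ?thesis by (intro disjI2) (auto elim!: eventually_mono)
    qed
  next
    case (Compl a)
    then show ?case using AE_space[of M] by (auto elim!: eventually_mono simp: R_def)
  next
    case (Union a)
    show ?case
    proof (cases "\<exists>i. AE x in M. x \<in> R \<longrightarrow> x \<in> a i")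
      case True
      then show ?thesis by (intro disjI1) (auto elim!: eventually_mono)
    next
      case False
      then have "AE x in M. \<forall>i. x \<in> R \<longrightarrow> x \<notin> a i"
        unfolding AE_all_countable using Union.IH by blast
      then show ?thesis by (intro disjI2) (auto elim!: eventually_mono)
    qed
  qed auto
  have atomR: "is_atom M G R" if "measure M R \<noteq> 0"
    unfolding is_atom_def
  proof (intro conjI ballI impI)
    show "0 < measure M R" using that by (simp add: zero_less_measure_iff)
    fix A assume A: "A \<in> sets G" "A \<subseteq> R \<and> measure M A < measure M R"
    have [measurable]: "A \<in> sets M" using A GM by auto
    have "A \<in> sigma_sets (space M) (\<A> \<union> null_sets M)" using A \<A> by auto
    from triv[OF this] show "measure M A = 0"
    proof
      assume "AE x in M. x \<in> R \<longrightarrow> x \<in> A"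
      then have "measure M R \<le> measure M A" by (intro finite_measure_mono_AE) auto
      with A show ?thesis by simp
    next
      assume "AE x in M. x \<in> R \<longrightarrow> x \<notin> A"
      then have "AE x in M. x \<notin> A" using A by (auto elim!: eventually_mono)
      then have "A \<in> null_sets M" by (simp add: AE_iff_null_sets)
      then show ?thesis by (auto simp: measure_def)
    qed
  qed (rule RG)
  define E where "E = from_nat_into (insert R \<A>)"
  define D where "D = disjointed E"
  have rE: "range E = insert R \<A>" using \<A>(1) by (simp add: E_def range_from_nat_into)
  have EG: "E i \<in> sets G" for i using rE RG \<A>(3) by (metis insertE rangeI subsetD)
  have E: "is_atom M G (E i) \<or> measure M (E i) = 0" for i
    using rE atomR \<A>(2) by (metis insertE rangeI)
  have DG: "D i \<in> sets G" for i
    using EG unfolding D_def disjointed_def by (intro sets.Diff sets.finite_UN) auto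
  have DE: "D i \<subseteq> E i" for i by (simp add: D_def disjointed_subset)
  have "is_atom M G (D i) \<or> measure M (D i) = 0" for i
  proof (rule disjCI)
    assume nz: "measure M (D i) \<noteq> 0"
    have le: "measure M (D i) \<le> measure M (E i)"
      using DE EG GM by (intro finite_measure_mono) auto
    with nz E[of i] have at: "is_atom M G (E i)" by (metis measure_le_0_iff)
    have "measure M (D i) = measure M (E i)"
      using at DG[of i] DE[of i] nz le unfolding is_atom_def by force
    then show "is_atom M G (D i)"
      using at DG[of i] DE[of i] unfolding is_atom_def by auto
  qed
  moreover have "(\<Union>i. D i) = space M"
  proof -
    have "(\<Union>i. D i) = \<Union>(insert R \<A>)" by (simp add: D_def UN_disjointed_eq flip: rE)
    also have "\<dots> = space M" using \<A>(3) sets.sets_into_space[of _ G] by (auto simp: R_def sp)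
    finally show ?thesis .
  qed
  ultimately show ?thesis using DG
    by (intro exI[of _ D]) (auto simp: D_def disjoint_family_disjointed)
qed

section \<open>Powers of measurable functions on atoms\<close>

text \<open>The only place where the regularity of the exponent enters: with a modular at most
  \<open>1\<close>, the function \<open>u powr (p - 1)\<close> is comparable on an atom to a constant, up to a factor \<open>K\<close> and
  an additive error \<open>1\<close>.\<close>

lemma powr_le_on_atom:
  fixes u p :: "'a \<Rightarrow> real"
  assumes "prob_space M" "subalgebra M G" "is_atom M G B"
    and u: "u \<in> borel_measurable G" "\<And>x. 0 \<le> u x"
    and p: "p \<in> borel_measurable M" "AE x in M. 1 < p x" "AE x in M. p x \<le> P"
    and K: "1 \<le> K" "measure M B powr real_of_ereal (ess_inf_on M p B - ess_sup_on M p B) \<le> K"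
    and le1: "(\<integral>\<^sup>+ x. ennreal (u x powr p x) \<partial>M) \<le> 1"
  shows "\<exists>g\<ge>0. AE x in M. x \<in> B \<longrightarrow>
    u x powr (p x - 1) \<le> g \<and> g \<le> K * u x powr (p x - 1) + 1"
proof -
  interpret prob_space M by fact
  note [measurable] = p(1)
  have B[measurable]: "B \<in> sets M" and mB: "0 < measure M B"
    using assms(2,3) by (auto simp: is_atom_def subalgebra_def)
  have [measurable]: "u \<in> borel_measurable M"
    using u(1) assms(2) by (rule measurable_from_subalg[rotated])
  obtain s where s: "AE x in M. x \<in> B \<longrightarrow> u x = s"
    using is_atom_AE_const[OF assms(1-3) u(1)] by auto
  have "\<exists>x\<in>B. u x = s" by (rule AE_ex_on_atom[OF assms(1,3) s assms(2)])
  then have s0: "0 \<le> s" using u(2) by auto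
  define a where "a = ess_inf_on M p B"
  define b where "b = ess_sup_on M p B"
  have res: "(AE x in restrict_space M B. Q x) \<longleftrightarrow> (AE x in M. x \<in> B \<longrightarrow> Q x)" for Q
    by (simp add: AE_restrict_space_iff)
  have [measurable]: "p \<in> borel_measurable (restrict_space M B)" by (simp add: measurable_restrict_space1)
  have pb: "AE x in M. x \<in> B \<longrightarrow> ereal (p x) \<le> b"
    unfolding res[symmetric] b_def ess_sup_on_def by (rule esssup_AE)
  have "AE x in restrict_space M B. - ereal (p x) \<le> - a"
    unfolding a_def ess_inf_on_def using esssup_AE[of "\<lambda>x. - ereal (p x)" "restrict_space M B"] by simp
  then have pa: "AE x in M. x \<in> B \<longrightarrow> a \<le> ereal (p x)"
    unfolding res ereal_minus_le_minus .
  have bP: "b \<le> ereal P"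
    unfolding b_def ess_sup_on_def
    by (intro esssup_I) (use p(3) in \<open>auto simp: res elim: eventually_mono\<close>)
  have "esssup (restrict_space M B) (\<lambda>x. - ereal (p x)) \<le> - 1"
    by (intro esssup_I) (use p(2) in \<open>auto simp: res one_ereal_def elim: eventually_mono\<close>)
  then have "- (- 1) \<le> a" unfolding a_def ess_inf_on_def ereal_minus_le_minus .
  then have a1: "1 \<le> a" by simp
  have "\<exists>x\<in>B. a \<le> ereal (p x) \<and> ereal (p x) \<le> b"
    using pa pb by (intro AE_ex_on_atom[OF assms(1,3) _ assms(2)]) auto
  then have ab: "a \<le> b" by auto
  obtain a' where a': "a = ereal a'" using a1 ab bP by (cases a) (auto simp: one_ereal_def)
  obtain b' where b': "b = ereal b'" using a1 ab bP by (cases b) (auto simp: one_ereal_def)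
  have K': "measure M B powr (a' - b') \<le> K"
    using K(2) by (simp add: a_def[symmetric] b_def[symmetric] a' b')
  have pab: "AE x in M. x \<in> B \<longrightarrow> a' \<le> p x \<and> p x \<le> b'"
    using pa pb by (auto simp: a' b')
  show ?thesis
  proof (cases "s \<le> 1")
    case True
    have "AE x in M. x \<in> B \<longrightarrow> u x powr (p x - 1) \<le> 1 \<and> 1 \<le> K * u x powr (p x - 1) + 1"
      using s p(2)
    proof eventually_elim
      case (elim x)
      then show ?case using s0 True K(1) by (auto intro!: powr_le1)
    qed
    then show ?thesis by (intro exI[of _ 1]) auto
  next
    case False
    \<comment> \<open>Chebyshev, using \<open>s \<le> s powr p\<close> on \<open>B\<close>.\<close>
    have "s * measure M B \<le> 1"
    proof -
      have "ennreal (s * measure M B) = (\<integral>\<^sup>+x. ennreal s * indicator B x \<partial>M)"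
        using s0 by (simp add: nn_integral_cmult_indicator emeasure_eq_measure ennreal_mult)
      also have "\<dots> \<le> (\<integral>\<^sup>+ x. ennreal (u x powr p x) \<partial>M)"
      proof (rule nn_integral_mono_AE, use s p(2) in eventually_elim)
        case (elim x)
        have "s \<le> s powr p x" using elim False by (intro powr_mono[of 1 "p x" s, simplified]) auto
        then show ?case using elim by (auto simp: indicator_def intro!: ennreal_leI)
      qed
      finally show ?thesis using le1 by (metis ennreal_le_1 order_trans)
    qed
    then have sB: "s \<le> measure M B powr (-1)"
      using mB by (simp add: powr_minus field_simps)
    define g where "g = s powr (b' - 1)"
    have "AE x in M. x \<in> B \<longrightarrow> u x powr (p x - 1) \<le> g \<and> g \<le> K * u x powr (p x - 1) + 1"
      using s pab
    proof eventually_elim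
      case (elim x)
      show ?case
      proof
        assume x: "x \<in> B"
        have "g = s powr (b' - p x) * s powr (p x - 1)"
          by (simp add: g_def flip: powr_add)
        also have "\<dots> \<le> K * s powr (p x - 1)"
        proof (intro mult_right_mono)
          have "s powr (b' - p x) \<le> s powr (b' - a')"
            using False elim x by (intro powr_mono) auto
          also have "\<dots> \<le> (measure M B powr (-1)) powr (b' - a')"
            using sB s0 elim x by (intro powr_mono2) auto
          also have "\<dots> \<le> K" using K' unfolding powr_powr by simp
          finally show "s powr (b' - p x) \<le> K" .
        qed simp
        finally have "g \<le> K * s powr (p x - 1)" .
        moreover have "s powr (p x - 1) \<le> g"
          unfolding g_def using False elim x by (intro powr_mono) auto
        ultimately show "u x powr (p x - 1) \<le> g \<and> g \<le> K * u x powr (p x - 1) + 1"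
          using elim x by auto
      qed
    qed
    then show ?thesis by (intro exI[of _ g]) (auto simp: g_def)
  qed
qed

lemma nn_integral_suminf_disjoint:
  fixes f :: "'a \<Rightarrow> ennreal" and D :: "nat \<Rightarrow> 'a set"
  assumes "disjoint_family D" "(\<Union>i. D i) = space M" "\<And>i. D i \<in> sets M" "f \<in> borel_measurable M"
  shows "(\<integral>\<^sup>+x. f x \<partial>M) = (\<Sum>i. \<integral>\<^sup>+x\<in>D i. f x \<partial>M)"
proof -
  note [measurable] = assms(3,4)
  have "(\<Sum>i. \<integral>\<^sup>+x\<in>D i. f x \<partial>M) = (\<integral>\<^sup>+x. (\<Sum>i. f x * indicator (D i) x) \<partial>M)"
    by (intro nn_integral_suminf[symmetric]) measurable
  also have "\<dots> = (\<integral>\<^sup>+x. f x * indicator (\<Union>i. D i) x \<partial>M)"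
    by (simp add: suminf_indicator[OF assms(1)])
  also have "\<dots> = (\<integral>\<^sup>+x. f x \<partial>M)"
    using assms(2) by (intro nn_integral_cong) auto
  finally show ?thesis ..
qed

text \<open>Replaces \<open>c\<close> by \<open>\<eta>\<close> as if \<open>u powr (p - 1)\<close> were \<open>G\<close>-measurable. Typically \<open>c\<close> is the
  conditional expectation of \<open>\<eta>\<close>, but the inequality of the integrals over \<open>G\<close>-sets suffices, and
  unlike equality it survives truncation of \<open>c\<close>.\<close>

lemma nn_integral_mult_powr_le:
  fixes c \<eta> u p :: "'a \<Rightarrow> real"
  assumes "prob_space M" "subalgebra M G" "countably_atomic M G"
    and u: "u \<in> borel_measurable G" "\<And>x. 0 \<le> u x"
    and p: "p \<in> borel_measurable M" "AE x in M. 1 < p x" "AE x in M. p x \<le> P"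
    and K: "1 \<le> K" "\<And>B. is_atom M G B \<Longrightarrow>
        measure M B powr real_of_ereal (ess_inf_on M p B - ess_sup_on M p B) \<le> K"
    and le1: "(\<integral>\<^sup>+ x. ennreal (u x powr p x) \<partial>M) \<le> 1"
    and c: "c \<in> borel_measurable M" "\<And>x. 0 \<le> c x"
    and \<eta>: "\<eta> \<in> borel_measurable M" "\<And>x. 0 \<le> \<eta> x"
    and dom: "\<And>A. A \<in> sets G \<Longrightarrow> (\<integral>\<^sup>+x\<in>A. ennreal (c x) \<partial>M) \<le> (\<integral>\<^sup>+x\<in>A. ennreal (\<eta> x) \<partial>M)"
  shows "(\<integral>\<^sup>+ x. ennreal (c x * u x powr (p x - 1)) \<partial>M)
    \<le> (\<integral>\<^sup>+ x. ennreal (\<eta> x * (K * u x powr (p x - 1) + 1)) \<partial>M)"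
proof -
  interpret prob_space M by fact
  have [measurable]: "u \<in> borel_measurable M"
    using u(1) assms(2) by (rule measurable_from_subalg[rotated])
  note [measurable] = p(1) c(1) \<eta>(1)
  obtain D :: "nat \<Rightarrow> 'a set" where D: "disjoint_family D" "(\<Union>i. D i) = space M"
    "\<And>i. D i \<in> sets G" "\<And>i. is_atom M G (D i) \<or> measure M (D i) = 0"
    using countably_atomic_partition[OF assms(1-3)] by auto
  have [measurable]: "D i \<in> sets M" for i using D(3) assms(2) by (auto simp: subalgebra_def)
  let ?l = "\<lambda>x. ennreal (c x * u x powr (p x - 1))"
  let ?r = "\<lambda>x. ennreal (\<eta> x * (K * u x powr (p x - 1) + 1))"
  have "(\<integral>\<^sup>+x\<in>D i. ?l x \<partial>M) \<le> (\<integral>\<^sup>+x\<in>D i. ?r x \<partial>M)" for i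
  proof (cases "measure M (D i) = 0")
    case True
    then have "D i \<in> null_sets M" by (auto simp: null_sets_def emeasure_eq_measure)
    then show ?thesis by (simp add: nn_integral_null_set)
  next
    case False
    then have at: "is_atom M G (D i)" using D(4) by blast
    obtain g where g: "0 \<le> g" "AE x in M. x \<in> D i \<longrightarrow>
        u x powr (p x - 1) \<le> g \<and> g \<le> K * u x powr (p x - 1) + 1"
      using powr_le_on_atom[OF assms(1,2) at u p K(1) K(2)[OF at] le1] by auto
    have "(\<integral>\<^sup>+x\<in>D i. ?l x \<partial>M) \<le> (\<integral>\<^sup>+x. ennreal g * (ennreal (c x) * indicator (D i) x) \<partial>M)"
    proof (rule nn_integral_mono_AE, use g(2) in eventually_elim)
      case (elim x)
      then show ?case using c(2)[of x] g(1)
        by (auto simp: indicator_def mult.commute[of g] simp flip: ennreal_mult intro!: ennreal_leI mult_left_mono)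
    qed
    also have "\<dots> = ennreal g * (\<integral>\<^sup>+x\<in>D i. ennreal (c x) \<partial>M)"
      by (intro nn_integral_cmult) measurable
    also have "\<dots> \<le> ennreal g * (\<integral>\<^sup>+x\<in>D i. ennreal (\<eta> x) \<partial>M)"
      by (intro mult_left_mono dom D) auto
    also have "\<dots> = (\<integral>\<^sup>+x. ennreal g * (ennreal (\<eta> x) * indicator (D i) x) \<partial>M)"
      by (intro nn_integral_cmult[symmetric]) measurable
    also have "\<dots> \<le> (\<integral>\<^sup>+x\<in>D i. ?r x \<partial>M)"
    proof (rule nn_integral_mono_AE, use g(2) in eventually_elim)
      case (elim x)
      then show ?case using \<eta>(2)[of x] g(1)
        by (auto simp: indicator_def mult.commute[of g] simp flip: ennreal_mult intro!: ennreal_leI mult_left_mono)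
    qed
    finally show ?thesis .
  qed
  then have "(\<Sum>i. \<integral>\<^sup>+x\<in>D i. ?l x \<partial>M) \<le> (\<Sum>i. \<integral>\<^sup>+x\<in>D i. ?r x \<partial>M)"
    by (intro suminf_le) auto
  then show ?thesis
    by (subst (1 2) nn_integral_suminf_disjoint[OF D(1,2)]) auto
qed

section \<open>Modular estimates for finite sums\<close>

text \<open>The hypotheses shared by the modular estimates. The essential bounds on \<open>p\<close> are \<open>1\<close>
  (strict, almost everywhere) and a real number \<open>P\<close>; \<open>K\<close> is the constant in the regularity
  condition on the atoms.\<close>

locale atomic_filtration_exponent = prob_space M for M :: "'a measure" +
  fixes F :: "nat \<Rightarrow> 'a measure" and p :: "'a \<Rightarrow> real" and P K :: real
  assumes filt: "filtration (space M) F"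
    and subalg: "\<And>n. subalgebra M (F n)"
    and atomic: "\<And>n. countably_atomic M (F n)"
    and p: "p \<in> borel_measurable M" "AE x in M. 1 < p x" "AE x in M. p x \<le> P"
    and K: "1 \<le> K" "\<And>n B. is_atom M (F n) B \<Longrightarrow>
        measure M B powr real_of_ereal (ess_inf_on M p B - ess_sup_on M p B) \<le> K"
begin

lemma exponent_bound_pos: "0 < P"
proof -
  have "AE x in M. 0 < P" using p(2,3) by eventually_elim linarith
  then show ?thesis by simp
qed

lemma modular_sum_le:
  fixes c \<eta> :: "nat \<Rightarrow> 'a \<Rightarrow> real"
  assumes c: "\<And>k. c k \<in> borel_measurable (F k)" "\<And>k x. 0 \<le> c k x"
    and \<eta>: "\<And>k. \<eta> k \<in> borel_measurable M" "\<And>k x. 0 \<le> \<eta> k x"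
    and dom: "\<And>k A. A \<in> sets (F k) \<Longrightarrow> (\<integral>\<^sup>+x\<in>A. ennreal (c k x) \<partial>M) \<le> (\<integral>\<^sup>+x\<in>A. ennreal (\<eta> k x) \<partial>M)"
    and le1: "(\<integral>\<^sup>+ x. ennreal ((\<Sum>k<N. c k x) powr p x) \<partial>M) \<le> 1"
  shows "(\<integral>\<^sup>+ x. ennreal ((\<Sum>k<N. c k x) powr p x) \<partial>M)
    \<le> ennreal P * (\<integral>\<^sup>+ x. ennreal ((\<Sum>k<N. \<eta> k x) * (K * (\<Sum>k<N. c k x) powr (p x - 1) + 1)) \<partial>M)"
proof -
  interpret filtration "space M" F by (rule filt)
  define U where "U n x = (\<Sum>k<n. c k x)" for n x
  have U0: "0 \<le> U n x" for n x using c(2) by (auto simp: U_def intro: sum_nonneg)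
  have Umono: "U m x \<le> U n x" if "m \<le> n" for m n x
    unfolding U_def using that c(2) by (intro sum_mono2) auto
  have "c i \<in> borel_measurable (F k)" if "i \<le> k" for i k
    using c(1)[of i] sets_F_mono[OF that]
    by (intro measurable_from_subalg[of "F k" "F i"]) (auto simp: subalgebra_def space_F)
  then have U_meas: "U (Suc k) \<in> borel_measurable (F k)" for k
    unfolding U_def by (intro borel_measurable_sum) auto
  have [measurable]: "c k \<in> borel_measurable M" for k
    using c(1) subalg by (rule measurable_from_subalg[rotated])
  have [measurable]: "U n \<in> borel_measurable M" for n unfolding U_def by measurable
  note [measurable] = p(1) \<eta>(1)
  note P0 = exponent_bound_pos
  have le1': "(\<integral>\<^sup>+ x. ennreal (U (Suc k) x powr p x) \<partial>M) \<le> 1" if "k < N" for k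
  proof -
    have "(\<integral>\<^sup>+ x. ennreal (U (Suc k) x powr p x) \<partial>M) \<le> (\<integral>\<^sup>+ x. ennreal (U N x powr p x) \<partial>M)"
      by (rule nn_integral_mono_AE, use p(2) in eventually_elim)
        (use that in \<open>auto intro!: ennreal_leI powr_mono2 U0 Umono\<close>)
    then show ?thesis using le1 by (simp add: U_def)
  qed
  have "(\<integral>\<^sup>+ x. ennreal (U N x powr p x) \<partial>M)
      \<le> (\<integral>\<^sup>+ x. ennreal (P * (\<Sum>k<N. c k x * U (Suc k) x powr (p x - 1))) \<partial>M)"
  proof (rule nn_integral_mono_AE, use p(2,3) in eventually_elim)
    case (elim x)
    have "U n x powr p x \<le> P * (\<Sum>k<n. c k x * U (Suc k) x powr (p x - 1))" for n
    proof (induction n)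
      case 0
      then show ?case by (simp add: U_def)
    next
      case (Suc n)
      have "U (Suc n) x powr p x \<le> U n x powr p x + p x * (c n x * U (Suc n) x powr (p x - 1))"
        using powr_increment_le[OF U0 c(2) elim(1), of n x n] by (simp add: U_def)
      also have "\<dots> \<le> U n x powr p x + P * (c n x * U (Suc n) x powr (p x - 1))"
        using elim c(2) by (intro add_left_mono mult_right_mono) auto
      finally show ?case using Suc by (simp add: algebra_simps)
    qed
    then show ?case by (intro ennreal_leI)
  qed
  also have "\<dots> = ennreal P * (\<Sum>k<N. \<integral>\<^sup>+ x. ennreal (c k x * U (Suc k) x powr (p x - 1)) \<partial>M)"
    using P0 c(2) by (simp add: ennreal_mult sum_nonneg nn_integral_cmult nn_integral_sum flip: sum_ennreal)
  also have "\<dots> \<le> ennreal P * (\<Sum>k<N. \<integral>\<^sup>+ x. ennreal (\<eta> k x * (K * U N x powr (p x - 1) + 1)) \<partial>M)"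
  proof (intro mult_left_mono sum_mono)
    fix k assume "k \<in> {..<N}"
    then have k: "k < N" by simp
    have "(\<integral>\<^sup>+ x. ennreal (c k x * U (Suc k) x powr (p x - 1)) \<partial>M)
      \<le> (\<integral>\<^sup>+ x. ennreal (\<eta> k x * (K * U (Suc k) x powr (p x - 1) + 1)) \<partial>M)"
      by (rule nn_integral_mult_powr_le[OF prob_space_axioms subalg atomic U_meas U0 p K(1) K(2) le1'[OF k] _ c(2) \<eta> dom]) auto
    also have "\<dots> \<le> (\<integral>\<^sup>+ x. ennreal (\<eta> k x * (K * U N x powr (p x - 1) + 1)) \<partial>M)"
    proof (rule nn_integral_mono_AE, use p(2) in eventually_elim)
      case (elim x)
      have "U (Suc k) x powr (p x - 1) \<le> U N x powr (p x - 1)"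
        using elim k by (intro powr_mono2 U0 Umono) auto
      then show ?case using K(1) \<eta>(2)
        by (intro ennreal_leI mult_left_mono add_right_mono) auto
    qed
    finally show "(\<integral>\<^sup>+ x. ennreal (c k x * U (Suc k) x powr (p x - 1)) \<partial>M)
      \<le> (\<integral>\<^sup>+ x. ennreal (\<eta> k x * (K * U N x powr (p x - 1) + 1)) \<partial>M)" .
  qed simp
  also have "(\<Sum>k<N. \<integral>\<^sup>+ x. ennreal (\<eta> k x * (K * U N x powr (p x - 1) + 1)) \<partial>M)
     = (\<integral>\<^sup>+ x. ennreal ((\<Sum>k<N. \<eta> k x) * (K * U N x powr (p x - 1) + 1)) \<partial>M)"
    using \<eta>(2) K(1)
    by (subst nn_integral_sum[symmetric]) (auto simp: sum_distrib_right intro!: nn_integral_cong sum_ennreal)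
  finally show ?thesis by (simp add: U_def)
qed

text \<open>The right-hand side decays in \<open>l\<close>, although the modular was only assumed to be at
  most \<open>1\<close>. It comes from the previous lemma for \<open>c / l\<close> and \<open>\<eta> / l\<close>, where the factor \<open>1 / l\<close> of
  \<open>\<eta> / l\<close> is pulled out and the rest is estimated by the modulars of \<open>\<eta>\<close> and \<open>c / l\<close>.\<close>

lemma modular_scaled_sum_le:
  fixes c \<eta> :: "nat \<Rightarrow> 'a \<Rightarrow> real"
  assumes c: "\<And>k. c k \<in> borel_measurable (F k)" "\<And>k x. 0 \<le> c k x"
    and \<eta>: "\<And>k. \<eta> k \<in> borel_measurable M" "\<And>k x. 0 \<le> \<eta> k x"
    and dom: "\<And>k A. A \<in> sets (F k) \<Longrightarrow> (\<integral>\<^sup>+x\<in>A. ennreal (c k x) \<partial>M) \<le> (\<integral>\<^sup>+x\<in>A. ennreal (\<eta> k x) \<partial>M)"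
    and \<eta>1: "(\<integral>\<^sup>+ x. ennreal ((\<Sum>k<N. \<eta> k x) powr p x) \<partial>M) \<le> 1"
    and l: "0 < l" "(\<integral>\<^sup>+ x. ennreal (((\<Sum>k<N. c k x) / l) powr p x) \<partial>M) \<le> 1"
  shows "(\<integral>\<^sup>+ x. ennreal (((\<Sum>k<N. c k x) / l) powr p x) \<partial>M) \<le> ennreal (P * (2 * K + 2) / l)"
proof -
  let ?u = "\<lambda>x. (\<Sum>k<N. c k x) / l"
  let ?f = "\<lambda>x. (\<Sum>k<N. \<eta> k x)"
  have [measurable]: "c k \<in> borel_measurable M" for k
    using c(1) subalg by (rule measurable_from_subalg[rotated])
  note [measurable] = p(1) \<eta>(1)
  note P0 = exponent_bound_pos
  have u: "0 \<le> ?u x" and f: "0 \<le> ?f x" for x using c \<eta> l by (auto intro!: sum_nonneg divide_nonneg_pos)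
  have "(\<integral>\<^sup>+ x. ennreal ((\<Sum>k<N. c k x / l) powr p x) \<partial>M)
    \<le> ennreal P * (\<integral>\<^sup>+ x. ennreal ((\<Sum>k<N. \<eta> k x / l) * (K * (\<Sum>k<N. c k x / l) powr (p x - 1) + 1)) \<partial>M)"
  proof (rule modular_sum_le)
    fix k A assume A: "A \<in> sets (F k)"
    then have [measurable]: "A \<in> sets M" using subalg by (auto simp: subalgebra_def)
    have sc: "(\<integral>\<^sup>+x\<in>A. ennreal (h x / l) \<partial>M) = (\<integral>\<^sup>+x\<in>A. ennreal (h x) \<partial>M) / ennreal l"
      if [measurable]: "h \<in> borel_measurable M" and "\<And>x. 0 \<le> h x" for h
      using l(1) that(2) by (subst nn_integral_divide[symmetric])
        (auto intro!: nn_integral_cong simp: indicator_def divide_ennreal)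
    show "(\<integral>\<^sup>+x\<in>A. ennreal (c k x / l) \<partial>M) \<le> (\<integral>\<^sup>+x\<in>A. ennreal (\<eta> k x / l) \<partial>M)"
      using dom[OF A] c(2) \<eta>(2) by (simp add: sc divide_right_mono_ennreal)
  next
    show "(\<lambda>x. c k x / l) \<in> borel_measurable (F k)" for k
      using c(1)[of k] by measurable
  qed (use c \<eta> l in \<open>auto simp: sum_divide_distrib\<close>)
  also have "\<dots> = ennreal P * (\<integral>\<^sup>+ x. ennreal (?f x / l * (K * ?u x powr (p x - 1) + 1)) \<partial>M)"
    by (simp add: sum_divide_distrib)
  also have "\<dots> \<le> ennreal P * (\<integral>\<^sup>+ x. ennreal (1 / l) * ((ennreal (K + 1) * ennreal (?f x powr p x) +
      ennreal K * ennreal (?u x powr p x)) + 1) \<partial>M)"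
  proof (intro mult_left_mono nn_integral_mono_AE)
    show "AE x in M. ennreal (?f x / l * (K * ?u x powr (p x - 1) + 1)) \<le>
      ennreal (1 / l) * ((ennreal (K + 1) * ennreal (?f x powr p x) + ennreal K * ennreal (?u x powr p x)) + 1)"
      using p(2)
    proof eventually_elim
      case (elim x)
      have "?f x * ?u x powr (p x - 1) \<le> ?f x powr p x + ?u x powr p x"
        by (rule mult_powr_minus_one_le[OF f u elim])
      then have "K * (?f x * ?u x powr (p x - 1)) \<le> K * (?f x powr p x + ?u x powr p x)"
        using K(1) by (intro mult_left_mono) auto
      moreover have "?f x \<le> ?f x powr p x + 1"
        using mult_powr_minus_one_le[OF f _ elim, of 1] by simp
      ultimately have "?f x * (K * ?u x powr (p x - 1) + 1) \<le>
          (K + 1) * ?f x powr p x + K * ?u x powr p x + 1"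
        by (simp add: algebra_simps)
      then have "?f x / l * (K * ?u x powr (p x - 1) + 1) \<le>
          1 / l * ((K + 1) * ?f x powr p x + K * ?u x powr p x + 1)"
        using l(1) by (simp add: divide_right_mono)
      then have "ennreal (?f x / l * (K * ?u x powr (p x - 1) + 1)) \<le>
          ennreal (1 / l * ((K + 1) * ?f x powr p x + K * ?u x powr p x + 1))"
        by (rule ennreal_leI)
      also have "\<dots> = ennreal (1 / l) * ((ennreal (K + 1) * ennreal (?f x powr p x) + ennreal K * ennreal (?u x powr p x)) + 1)"
        using K(1) l(1) by (simp flip: ennreal_mult ennreal_plus ennreal_1)
      finally show ?case .
    qed
  qed simp
  also have "\<dots> = ennreal P * (ennreal (1 / l) * ((ennreal (K + 1) * (\<integral>\<^sup>+ x. ennreal (?f x powr p x) \<partial>M) +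
      ennreal K * (\<integral>\<^sup>+ x. ennreal (?u x powr p x) \<partial>M)) + 1))"
    by (simp add: nn_integral_cmult nn_integral_add emeasure_space_1)
  also have "\<dots> \<le> ennreal P * (ennreal (1 / l) * ((ennreal (K + 1) * 1 + ennreal K * 1) + 1))"
    using \<eta>1 l(2) by (intro mult_left_mono add_mono) auto
  also have "\<dots> = ennreal P * (ennreal (1 / l) * ennreal (2 * K + 2))"
  proof -
    have "ennreal (K + 1) * 1 + ennreal K * 1 + 1 = ennreal (K + 1) + ennreal K + ennreal 1"
      by (simp only: mult_1_right ennreal_1)
    also have "\<dots> = ennreal (2 * K + 2)"
      using K(1) by (simp flip: ennreal_plus ennreal_1)
    finally show ?thesis by simp
  qed
  also have "\<dots> = ennreal (P * (2 * K + 2) / l)"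
    using K(1) P0 l(1) by (simp del: ennreal_plus flip: ennreal_mult)
  finally show ?thesis by (simp add: sum_divide_distrib)
qed

text \<open>The uniform bound \<open>m\<close> serves only to provide some admissible scale; the constant
  does not depend on it.\<close>

lemma modular_bounded_sum_le_1:
  fixes c \<eta> :: "nat \<Rightarrow> 'a \<Rightarrow> real"
  assumes c: "\<And>k. c k \<in> borel_measurable (F k)" "\<And>k x. 0 \<le> c k x" "\<And>k x. c k x \<le> m"
    and \<eta>: "\<And>k. \<eta> k \<in> borel_measurable M" "\<And>k x. 0 \<le> \<eta> k x"
    and dom: "\<And>k A. A \<in> sets (F k) \<Longrightarrow> (\<integral>\<^sup>+x\<in>A. ennreal (c k x) \<partial>M) \<le> (\<integral>\<^sup>+x\<in>A. ennreal (\<eta> k x) \<partial>M)"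
    and \<eta>1: "(\<integral>\<^sup>+ x. ennreal ((\<Sum>k<N. \<eta> k x) powr p x) \<partial>M) \<le> 1"
  shows "(\<integral>\<^sup>+ x. ennreal (((\<Sum>k<N. c k x) / (2 powr P * (P * (2 * K + 2)))) powr p x) \<partial>M) \<le> 1"
proof -
  define S where "S x = (\<Sum>k<N. c k x)" for x
  define C where "C = 2 powr P * (P * (2 * K + 2))"
  define adm where "adm l \<longleftrightarrow> (\<integral>\<^sup>+ x. ennreal ((S x / l) powr p x) \<partial>M) \<le> 1" for l
  have [measurable]: "c k \<in> borel_measurable M" for k
    using c(1) subalg by (rule measurable_from_subalg[rotated])
  have [measurable]: "S \<in> borel_measurable M" unfolding S_def by measurable
  note [measurable] = p(1)
  have C0: "0 < C" using exponent_bound_pos K(1) by (simp add: C_def)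
  have S0: "0 \<le> S x" for x using c(2) by (auto simp: S_def intro: sum_nonneg)
  have adm_mono: "adm l'" if "adm l" "0 < l" "l \<le> l'" for l l'
  proof -
    have "(\<integral>\<^sup>+ x. ennreal ((S x / l') powr p x) \<partial>M) \<le> (\<integral>\<^sup>+ x. ennreal ((S x / l) powr p x) \<partial>M)"
    proof (rule nn_integral_mono_AE, use p(2) in eventually_elim)
      case (elim x)
      then show ?case using that S0[of x]
        by (intro ennreal_leI powr_mono2 divide_left_mono divide_nonneg_pos) auto
    qed
    with that(1) show ?thesis by (simp add: adm_def)
  qed
  have adm_half: "adm (l / 2)" if "adm l" "C \<le> l" for l
  proof -
    have l: "0 < l" using that C0 by simp
    have "(\<integral>\<^sup>+ x. ennreal ((S x / (l / 2)) powr p x) \<partial>M)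
        \<le> (\<integral>\<^sup>+ x. ennreal (2 powr P) * ennreal ((S x / l) powr p x) \<partial>M)"
    proof (rule nn_integral_mono_AE, use p(3) in eventually_elim)
      case (elim x)
      have "(S x / (l / 2)) powr p x = 2 powr p x * (S x / l) powr p x"
        using S0[of x] l by (subst powr_mult[symmetric]) (auto simp: field_simps)
      also have "\<dots> \<le> 2 powr P * (S x / l) powr p x"
        using elim by (intro mult_right_mono powr_mono) auto
      finally show ?case by (simp add: ennreal_leI flip: ennreal_mult)
    qed
    also have "\<dots> = ennreal (2 powr P) * (\<integral>\<^sup>+ x. ennreal ((S x / l) powr p x) \<partial>M)"
      by (intro nn_integral_cmult) measurable
    also have "\<dots> \<le> ennreal (2 powr P) * ennreal (P * (2 * K + 2) / l)"
      using modular_scaled_sum_le[OF c(1,2) \<eta> dom \<eta>1 l] that(1)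
      by (intro mult_left_mono) (auto simp: adm_def S_def)
    also have "\<dots> = ennreal (C / l)"
      by (simp add: C_def flip: ennreal_mult')
    also have "\<dots> \<le> 1" using that(2) l by (simp add: field_simps)
    finally show ?thesis by (simp add: adm_def)
  qed
  define L where "L = real N * m + C"
  have m0: "0 \<le> m" using c(2,3)[of 0] order_trans by blast
  have "adm L"
  proof -
    have "(\<integral>\<^sup>+ x. ennreal ((S x / L) powr p x) \<partial>M) \<le> (\<integral>\<^sup>+ x. 1 \<partial>M)"
    proof (rule nn_integral_mono_AE, use p(2) in eventually_elim)
      case (elim x)
      have "S x \<le> real N * m"
        using sum_bounded_above[of "{..<N}" "\<lambda>k. c k x" m] c(3) by (simp add: S_def)
      then have "S x / L \<le> 1" "0 \<le> S x / L" using S0[of x] C0 by (auto simp: L_def)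
      then show ?case using elim by (auto intro!: powr_le1)
    qed
    then show ?thesis by (simp add: adm_def emeasure_space_1)
  qed
  \<comment> \<open>Halving continues until the scale drops below \<open>C\<close>.\<close>
  have iter: "adm (max C (L / 2 ^ j))" for j
  proof (induction j)
    case 0
    show ?case using \<open>adm L\<close> m0 by (simp add: L_def max_def)
  next
    case (Suc j)
    show ?case
      by (rule adm_mono[OF adm_half[OF Suc]]) (use C0 in \<open>auto simp: max_def\<close>)
  qed
  obtain j where "L / C < 2 ^ j" using real_arch_pow[of 2 "L / C"] by auto
  then have "L / 2 ^ j \<le> C" using C0 by (simp add: field_simps)
  with iter[of j] have "adm C" by (simp add: max_def)
  then show ?thesis by (simp add: adm_def S_def C_def)
qed

end

section \<open>Extended powers and conditional expectations\<close>

lemma epowr_ennreal: "0 \<le> z \<Longrightarrow> epowr (ennreal z) q = ennreal (z powr q)"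
  by (simp add: epowr_def)

lemma epowr_mono:
  assumes "s \<le> t" "0 \<le> q"
  shows "epowr s q \<le> epowr t q"
proof (cases "t = \<infinity>")
  case False
  with assms have "s \<noteq> \<infinity>" by (auto simp: top_unique)
  with False show ?thesis using assms
    by (auto simp: epowr_def less_top intro!: ennreal_leI powr_mono2 enn2real_mono)
qed (simp add: epowr_def)

text \<open>The sequence \<open>T\<close> exhausts the partial sums of \<open>b\<close>; the series may diverge.\<close>

lemma epowr_suminf_le_SUP:
  fixes b T :: "nat \<Rightarrow> real"
  assumes "0 < q" "\<And>k. 0 \<le> b k" "\<And>n. \<exists>N. (\<Sum>k<n. b k) \<le> T N"
  shows "epowr (\<Sum>k. ennreal (b k)) q \<le> (SUP N. ennreal (T N powr q))"
proof (cases "SUP N. ennreal (T N powr q)")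
  case (real r)
  have "(\<Sum>k<n. b k) \<le> r powr (1 / q)" for n
  proof -
    obtain N where N: "(\<Sum>k<n. b k) \<le> T N" using assms(3) by auto
    have s0: "0 \<le> (\<Sum>k<n. b k)" using assms(2) by (simp add: sum_nonneg)
    have "ennreal (T N powr q) \<le> ennreal r" unfolding real(2)[symmetric] by (rule SUP_upper) simp
    then have "T N powr q \<le> r" using real by simp
    then have "(T N powr q) powr (1 / q) \<le> r powr (1 / q)"
      using assms(1) by (intro powr_mono2) auto
    then show ?thesis using N s0 assms(1) by (simp add: powr_powr)
  qed
  then have "(\<Sum>k<n. ennreal (b k)) \<le> ennreal (r powr (1 / q))" for n
    using assms(2) by (subst sum_ennreal) (auto intro: ennreal_leI)
  then have "(\<Sum>k. ennreal (b k)) \<le> ennreal (r powr (1 / q))"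
    by (intro suminf_le_const summableI)
  then have "epowr (\<Sum>k. ennreal (b k)) q \<le> epowr (ennreal (r powr (1 / q))) q"
    using assms(1) by (intro epowr_mono) auto
  also have "\<dots> = ennreal r" using real assms(1) by (simp add: epowr_ennreal powr_powr)
  finally show ?thesis by (simp add: real)
next
  case top
  show ?thesis unfolding top by (rule top_greatest)
qed

text \<open>Integrability of \<open>f\<close> is not needed: if the conditional expectation of the positive or
  the negative part is infinite, \<open>enn2real\<close> turns it into \<open>0\<close>, and the absolute value of the
  difference of the two parts is still at most their sum.\<close>

lemma (in sigma_finite_subalgebra) nn_integral_abs_real_cond_exp_le:
  assumes [measurable]: "f \<in> borel_measurable M" and A: "A \<in> sets F"
  shows "(\<integral>\<^sup>+x\<in>A. ennreal \<bar>real_cond_exp M F f x\<bar> \<partial>M) \<le> (\<integral>\<^sup>+x\<in>A. ennreal \<bar>f x\<bar> \<partial>M)"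
proof -
  have [measurable]: "A \<in> sets M" using A subalg by (auto simp: subalgebra_def)
  let ?p = "nn_cond_exp M F (\<lambda>x. ennreal (f x))" and ?n = "nn_cond_exp M F (\<lambda>x. ennreal (- f x))"
  have "ennreal \<bar>enn2real s - enn2real t\<bar> \<le> s + t" for s t
  proof -
    have "ennreal \<bar>enn2real s - enn2real t\<bar> \<le> ennreal (enn2real s + enn2real t)"
      by (intro ennreal_leI) (smt (verit) enn2real_nonneg)
    also have "\<dots> = ennreal (enn2real s) + ennreal (enn2real t)" by simp
    also have "\<dots> \<le> s + t" by (intro add_mono) (auto simp: ennreal_enn2real_if)
    finally show ?thesis .
  qed
  then have "(\<integral>\<^sup>+x\<in>A. ennreal \<bar>real_cond_exp M F f x\<bar> \<partial>M) \<le>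
      (\<integral>\<^sup>+x. indicator A x * ?p x + indicator A x * ?n x \<partial>M)"
    by (intro nn_integral_mono) (auto simp: indicator_def real_cond_exp_def)
  also have "\<dots> = (\<integral>\<^sup>+x. indicator A x * ennreal (f x) \<partial>M) + (\<integral>\<^sup>+x. indicator A x * ennreal (- f x) \<partial>M)"
    using A by (simp add: nn_integral_add nn_cond_exp_intg)
  also have "\<dots> = (\<integral>\<^sup>+x. indicator A x * ennreal (f x) + indicator A x * ennreal (- f x) \<partial>M)"
    by (intro nn_integral_add[symmetric]) measurable
  also have "\<dots> = (\<integral>\<^sup>+x\<in>A. ennreal \<bar>f x\<bar> \<partial>M)"
    by (intro nn_integral_cong) (auto simp: indicator_def abs_if ennreal_neg)
  finally show ?thesis .
qed

section \<open>The norm inequality\<close>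

theorem proposition2p24:
  fixes M :: "'a measure" and F :: "nat \<Rightarrow> 'a measure" and p :: "'a \<Rightarrow> real" and K :: real
  assumes "prob_space M" and "complete_measure M"
    and "filtration (space M) F" and "\<And>n. subalgebra M (F n)"
    and "generated_mod_null M M (\<Union>n. sets (F n))"
    and "\<And>n. countably_atomic M (F n)"
    and "p \<in> borel_measurable M" and "\<And>x. x \<in> space M \<Longrightarrow> 0 < p x"
    and "1 < ess_inf_on M p (space M)"
    and "ess_inf_on M p (space M) \<le> ess_sup_on M p (space M)"
    and "ess_sup_on M p (space M) < \<infinity>"
    and "1 \<le> K"
    and "\<And>n A. is_atom M (F n) A \<Longrightarrow>
           measure M A powr real_of_ereal (ess_inf_on M p A - ess_sup_on M p A) \<le> K"
  shows "\<exists>C::real. 0 < C \<and>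
    (\<forall>\<theta> :: nat \<Rightarrow> 'a \<Rightarrow> real. (\<forall>n. \<theta> n \<in> borel_measurable M) \<longrightarrow>
       var_norm M p (\<lambda>x. \<Sum>n. ennreal \<bar>real_cond_exp M (F n) (\<theta> n) x\<bar>)
         \<le> ennreal C * var_norm M p (\<lambda>x. \<Sum>n. ennreal \<bar>\<theta> n x\<bar>))"
proof -
  interpret prob_space M by fact
  note [measurable] = assms(7)
  have res: "(AE x in restrict_space M (space M). Q x) \<longleftrightarrow> (AE x in M. Q x)" for Q
    by (simp add: AE_restrict_space_iff)
  define P where "P = real_of_ereal (ess_sup_on M p (space M))"
  have P: "ess_sup_on M p (space M) = ereal P"
    unfolding P_def using assms(9-11) by (cases "ess_sup_on M p (space M)") auto
  have pP: "AE x in M. p x \<le> P"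
    using esssup_AE[of "\<lambda>x. ereal (p x)" "restrict_space M (space M)"]
    unfolding res P[unfolded ess_sup_on_def] by simp
  have "AE x in restrict_space M (space M). - ereal (p x) \<le> - ess_inf_on M p (space M)"
    unfolding ess_inf_on_def using esssup_AE[of "\<lambda>x. - ereal (p x)" "restrict_space M (space M)"] by simp
  then have "AE x in M. ess_inf_on M p (space M) \<le> ereal (p x)"
    unfolding res ereal_minus_le_minus .
  then have p1: "AE x in M. 1 < p x"
  proof eventually_elim
    case (elim x)
    with assms(9) have "1 < ereal (p x)" by (rule less_le_trans)
    then show ?case by (simp add: one_ereal_def)
  qed
  interpret atomic_filtration_exponent M F p P K
    by (intro atomic_filtration_exponent.intro atomic_filtration_exponent_axioms.intro assms p1 pP)
  define C where "C = 2 powr P * (P * (2 * K + 2))"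
  have C0: "0 < C" using exponent_bound_pos K(1) by (simp add: C_def)
  \<comment> \<open>If \<open>l\<close> is admissible for the right-hand norm, then \<open>C * l\<close> is for the left-hand one.\<close>
  have main: "(\<integral>\<^sup>+ x. epowr ((\<Sum>n. ennreal \<bar>real_cond_exp M (F n) (\<theta> n) x\<bar>) / ennreal (C * l)) (p x) \<partial>M) \<le> 1"
    if \<theta>[measurable]: "\<And>n. \<theta> n \<in> borel_measurable M" and l: "0 < l"
      and le1: "(\<integral>\<^sup>+ x. epowr ((\<Sum>n. ennreal \<bar>\<theta> n x\<bar>) / ennreal l) (p x) \<partial>M) \<le> 1" for \<theta> l
  proof -
    define \<eta> where "\<eta> k x = \<bar>\<theta> k x\<bar> / l" for k x
    define a where "a k x = \<bar>real_cond_exp M (F k) (\<theta> k) x\<bar> / l" for k x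
    \<comment> \<open>\<open>N\<close> is at once the number of summands and the level of truncation, so that a single
      monotone limit suffices.\<close>
    define T where "T N x = (\<Sum>k<N. min (a k x) (real N)) / C" for N x
    have a0: "0 \<le> a k x" and \<eta>0: "0 \<le> \<eta> k x" for k x using l by (auto simp: a_def \<eta>_def)
    have [measurable]: "\<eta> k \<in> borel_measurable M" "a k \<in> borel_measurable M" for k
      unfolding \<eta>_def a_def by measurable
    have aF: "a k \<in> borel_measurable (F k)" for k unfolding a_def by measurable
    have [measurable]: "T N \<in> borel_measurable M" for N unfolding T_def by measurable
    have dom: "(\<integral>\<^sup>+x\<in>A. ennreal (min (a k x) m) \<partial>M) \<le> (\<integral>\<^sup>+x\<in>A. ennreal (\<eta> k x) \<partial>M)"
      if A: "A \<in> sets (F k)" for A k m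
    proof -
      interpret finite_measure_subalgebra M "F k" by unfold_locales (rule assms(4))
      have [measurable]: "A \<in> sets M" using A assms(4) by (auto simp: subalgebra_def)
      have sc: "(\<integral>\<^sup>+x\<in>A. ennreal (\<bar>h x\<bar> / l) \<partial>M) = (\<integral>\<^sup>+x\<in>A. ennreal \<bar>h x\<bar> \<partial>M) / ennreal l"
        if [measurable]: "h \<in> borel_measurable M" for h :: "'a \<Rightarrow> real"
        using l by (subst nn_integral_divide[symmetric])
          (auto intro!: nn_integral_cong simp: indicator_def divide_ennreal)
      have "(\<integral>\<^sup>+x\<in>A. ennreal (min (a k x) m) \<partial>M) \<le> (\<integral>\<^sup>+x\<in>A. ennreal (a k x) \<partial>M)"
        by (intro nn_integral_mono mult_right_mono ennreal_leI) auto
      also have "\<dots> \<le> (\<integral>\<^sup>+x\<in>A. ennreal (\<eta> k x) \<partial>M)"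
        unfolding a_def \<eta>_def using nn_integral_abs_real_cond_exp_le[OF \<theta> A]
        by (simp add: sc divide_right_mono_ennreal)
      finally show ?thesis .
    qed
    have \<eta>1: "(\<integral>\<^sup>+ x. ennreal ((\<Sum>k<N. \<eta> k x) powr p x) \<partial>M) \<le> 1" for N
    proof -
      have "(\<integral>\<^sup>+ x. ennreal ((\<Sum>k<N. \<eta> k x) powr p x) \<partial>M) \<le>
          (\<integral>\<^sup>+ x. epowr ((\<Sum>n. ennreal \<bar>\<theta> n x\<bar>) / ennreal l) (p x) \<partial>M)"
      proof (rule nn_integral_mono)
        fix x assume x: "x \<in> space M"
        have "ennreal (\<Sum>k<N. \<eta> k x) = (\<Sum>k<N. ennreal (\<eta> k x))"
          using \<eta>0 by (simp add: sum_ennreal)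
        also have "\<dots> \<le> (\<Sum>k. ennreal (\<eta> k x))" by (intro sum_le_suminf summableI) auto
        also have "\<dots> = (\<Sum>n. ennreal \<bar>\<theta> n x\<bar>) / ennreal l"
          using l by (simp add: \<eta>_def flip: divide_ennreal)
        finally have "epowr (ennreal (\<Sum>k<N. \<eta> k x)) (p x) \<le> epowr ((\<Sum>n. ennreal \<bar>\<theta> n x\<bar>) / ennreal l) (p x)"
          using assms(8)[OF x] by (intro epowr_mono) auto
        then show "ennreal ((\<Sum>k<N. \<eta> k x) powr p x) \<le> epowr ((\<Sum>n. ennreal \<bar>\<theta> n x\<bar>) / ennreal l) (p x)"
          using \<eta>0 by (simp add: epowr_ennreal sum_nonneg)
      qed
      with le1 show ?thesis by simp
    qed
    have T1: "(\<integral>\<^sup>+ x. ennreal (T N x powr p x) \<partial>M) \<le> 1" for N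
      unfolding T_def C_def
    proof (rule modular_bounded_sum_le_1[where \<eta> = \<eta> and m = "real N"])
      show "(\<lambda>x. min (a k x) (real N)) \<in> borel_measurable (F k)" for k
        using aF[of k] by measurable
      show "min (a k x) (real N) \<le> real N" for k x by simp
    qed (use a0 \<eta>0 dom \<eta>1 in auto)
    have "(\<integral>\<^sup>+ x. epowr ((\<Sum>n. ennreal \<bar>real_cond_exp M (F n) (\<theta> n) x\<bar>) / ennreal (C * l)) (p x) \<partial>M)
        \<le> (\<integral>\<^sup>+ x. (SUP N. ennreal (T N x powr p x)) \<partial>M)"
    proof (rule nn_integral_mono)
      fix x assume x: "x \<in> space M"
      have "(\<Sum>n. ennreal \<bar>real_cond_exp M (F n) (\<theta> n) x\<bar>) / ennreal (C * l) = (\<Sum>n. ennreal (a n x / C))"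
        using l C0 by (simp add: a_def mult.commute flip: divide_ennreal ennreal_suminf_divide)
      moreover have "epowr (\<Sum>n. ennreal (a n x / C)) (p x) \<le> (SUP N. ennreal (T N x powr p x))"
      proof (rule epowr_suminf_le_SUP)
        fix n
        define N where "N = max n (nat \<lceil>\<Sum>k<n. a k x\<rceil>)"
        have "(\<Sum>k<n. a k x) \<le> (\<Sum>k<n. min (a k x) (real N))"
        proof (rule sum_mono)
          fix i assume "i \<in> {..<n}"
          then have "a i x \<le> (\<Sum>k<n. a k x)" using a0 by (intro member_le_sum) auto
          also have "\<dots> \<le> real N" unfolding N_def by linarith
          finally show "a i x \<le> min (a i x) (real N)" by simp
        qed
        also have "\<dots> \<le> (\<Sum>k<N. min (a k x) (real N))"
          using a0 by (intro sum_mono2) (auto simp: N_def)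
        finally have "(\<Sum>k<n. a k x / C) \<le> T N x"
          using C0 by (simp add: T_def divide_right_mono flip: sum_divide_distrib)
        then show "\<exists>N. (\<Sum>k<n. a k x / C) \<le> T N x" by auto
      qed (use assms(8)[OF x] a0 C0 in auto)
      ultimately show "epowr ((\<Sum>n. ennreal \<bar>real_cond_exp M (F n) (\<theta> n) x\<bar>) / ennreal (C * l)) (p x)
          \<le> (SUP N. ennreal (T N x powr p x))" by simp
    qed
    also have "\<dots> = (SUP N. \<integral>\<^sup>+ x. ennreal (T N x powr p x) \<partial>M)"
    proof (rule nn_integral_monotone_convergence_SUP_AE)
      fix N
      show "AE x in M. ennreal (T N x powr p x) \<le> ennreal (T (Suc N) x powr p x)"
        using p1
      proof eventually_elim
        case (elim x)
        have "(\<Sum>k<N. min (a k x) (real N)) \<le> (\<Sum>k<N. min (a k x) (real (Suc N)))"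
          by (intro sum_mono) auto
        also have "\<dots> \<le> (\<Sum>k<Suc N. min (a k x) (real (Suc N)))"
          using a0 by simp
        finally have "T N x \<le> T (Suc N) x"
          using C0 by (simp add: T_def divide_right_mono del: sum.lessThan_Suc)
        moreover have "0 \<le> T N x" using a0 C0 by (auto simp: T_def intro!: divide_nonneg_pos sum_nonneg)
        ultimately show ?case using elim by (intro ennreal_leI powr_mono2) auto
      qed
    qed measurable
    also have "\<dots> \<le> 1" by (intro SUP_least T1)
    finally show ?thesis .
  qed
  have "var_norm M p (\<lambda>x. \<Sum>n. ennreal \<bar>real_cond_exp M (F n) (\<theta> n) x\<bar>)
         \<le> ennreal C * var_norm M p (\<lambda>x. \<Sum>n. ennreal \<bar>\<theta> n x\<bar>)" (is "?L \<le> _ * ?R")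
    if \<theta>: "\<And>n. \<theta> n \<in> borel_measurable M" for \<theta>
  proof -
    have "?L / ennreal C \<le> ?R"
      unfolding var_norm_def[of M p "\<lambda>x. \<Sum>n. ennreal \<bar>\<theta> n x\<bar>"]
    proof (rule Inf_greatest, clarify)
      fix l :: real
      assume l: "0 < l" "(\<integral>\<^sup>+ x. epowr ((\<Sum>n. ennreal \<bar>\<theta> n x\<bar>) / ennreal l) (p x) \<partial>M) \<le> 1"
      have "?L \<le> ennreal (C * l)"
        unfolding var_norm_def using main[OF \<theta> l] C0 l(1) by (intro Inf_lower) auto
      also have "\<dots> = ennreal l * ennreal C" using C0 l(1) by (simp add: ennreal_mult mult.commute)
      finally have "?L / ennreal C \<le> ennreal l * ennreal C / ennreal C"
        by (rule divide_right_mono_ennreal)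
      also have "\<dots> = ennreal l" using C0 l(1) by (simp add: divide_ennreal flip: ennreal_mult)
      finally show "?L / ennreal C \<le> ennreal l" .
    qed
    then have "ennreal C * (?L / ennreal C) \<le> ennreal C * ?R" by (intro mult_left_mono) auto
    then show ?thesis using C0
      by (simp add: ennreal_times_divide mult_divide_eq_ennreal mult.commute[of "ennreal C" ?L])
  qed
  with C0 show ?thesis by blast
qed

end
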